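(* Let $P(x)=x^4+k_2x^2+k_3x+k_4$ be a real polynomial with $P(x)\neq x^4$. If $P(x)$ is not of the form $x^4+k_2x^2+\left(\frac{k_2}{2}\right)^2$ with $k_2<0$, then $P(x)$ is $\mathcal{R}$ if and only if $P(x)$ is $\mathcal{IR}$. If $P(x)=x^4+k_2x^2+\left(\frac{k_2}{2}\right)^2$ with $k_2<0$, then $P(x)$ is not $\mathcal{IR}$.
   Context: A monic real polynomial $P(x)$ of degree $n$ is realizable ($\mathcal{R}$) if it is the characteristic polynomial of some $n\times n$ entrywise nonnegative matrix; it is irreducibly realizable ($\mathcal{IR}$) if it is the characteristic polynomial of some $n\times n$ irreducible entrywise nonnegative matrix. A square matrix is irreducible if it is not similar by a permutation matrix to a nontrivially block triangular matrix (equivalently, its digraph is strongly connected). *)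

theory Defs
  imports "Jordan_Normal_Form.Char_Poly"
begin

definition nonneg_mat :: "real mat \<Rightarrow> bool" where
  "nonneg_mat A \<longleftrightarrow> (\<forall>i < dim_row A. \<forall>j < dim_col A. 0 \<le> A $$ (i, j))"

definition permutation_mat :: "nat \<Rightarrow> real mat \<Rightarrow> bool" where
  "permutation_mat n P \<longleftrightarrow>
     (\<exists>p. p permutes {..<n} \<and> P = mat n n (\<lambda>(i, j). if j = p i then 1 else 0))"

(* A nontrivial block triangular form always coarsens to two diagonal blocks, and conjugating by
   a further permutation matrix exchanges upper and lower triangular forms, so considering
   upper triangular forms with two diagonal blocks is no restriction. *)
definition block_triangular_mat :: "nat \<Rightarrow> real mat \<Rightarrow> bool" where
  "block_triangular_mat n T \<longleftrightarrow>
     (\<exists>k B C D. 0 < k \<and> k < n \<and>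
        B \<in> carrier_mat k k \<and> C \<in> carrier_mat k (n - k) \<and> D \<in> carrier_mat (n - k) (n - k) \<and>
        T = four_block_mat B C (0\<^sub>m (n - k) k) D)"

definition irreducible_mat :: "real mat \<Rightarrow> bool" where
  "irreducible_mat A \<longleftrightarrow> square_mat A \<and>
     \<not> (\<exists>P Q T. permutation_mat (dim_row A) P \<and> similar_mat_wit A T P Q \<and>
          block_triangular_mat (dim_row A) T)"

(* The characteristic polynomial of an n x n matrix is monic of degree n, so neither predicate
   needs to require that p be monic. *)
definition realizable :: "real poly \<Rightarrow> bool" where
  "realizable p \<longleftrightarrow>
     (\<exists>A \<in> carrier_mat (degree p) (degree p). nonneg_mat A \<and> char_poly A = p)"

definition irreducibly_realizable :: "real poly \<Rightarrow> bool" where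
  "irreducibly_realizable p \<longleftrightarrow>
     (\<exists>A \<in> carrier_mat (degree p) (degree p).
        nonneg_mat A \<and> irreducible_mat A \<and> char_poly A = p)"

end

theory Submission
  imports Defs
begin

text \<open>
  A nonnegative matrix with characteristic polynomial \<open>x\<^sup>4 + k\<^sub>2 x\<^sup>2 + k\<^sub>3 x + k\<^sub>4\<close> has trace zero,
  hence zero diagonal, and the coefficients are signed sums of weights of cycles of its digraph:
  \<open>- k\<^sub>2\<close> and \<open>- k\<^sub>3\<close> are the total weights of the 2- and 3-cycles, and \<open>k\<^sub>4\<close> is the sum over
  pairs of disjoint 2-cycles minus the total weight of the 4-cycles. This forces \<open>k\<^sub>2 \<le> 0\<close>,
  \<open>k\<^sub>3 \<le> 0\<close> and \<open>4 k\<^sub>4 \<le> k\<^sub>2\<^sup>2\<close>, and under these conditions explicit strongly connected digraphs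
  realize the polynomial, except when \<open>k\<^sub>3 = 0\<close> and \<open>4 k\<^sub>4 = k\<^sub>2\<^sup>2 > 0\<close>. In that case equality in the
  last bound leaves just two disjoint 2-cycles, and the absence of 3- and 4-cycles allows edges
  between them in one direction only.
\<close>

section \<open>Determinants and characteristic polynomials of order four\<close>

lemma det_2:
  assumes "A \<in> carrier_mat 2 2"
  shows "det A = A $$ (0,0) * A $$ (1,1) - A $$ (0,1) * A $$ (1,0)"
proof -
  have "det A = (\<Sum>j<2. A $$ (0,j) * cofactor A 0 j)"
    using assms by (rule laplace_expansion_row) simp
  also have "\<dots> = A $$ (0,0) * A $$ (1,1) - A $$ (0,1) * A $$ (1,0)"
    using assms by (simp add: eval_nat_numeral cofactor_def mat_delete_def det_single)
  finally show ?thesis .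
qed

lemma det_3:
  assumes "A \<in> carrier_mat 3 3"
  shows "det A =
    A $$ (0,0) * (A $$ (1,1) * A $$ (2,2) - A $$ (1,2) * A $$ (2,1))
    - A $$ (0,1) * (A $$ (1,0) * A $$ (2,2) - A $$ (1,2) * A $$ (2,0))
    + A $$ (0,2) * (A $$ (1,0) * A $$ (2,1) - A $$ (1,1) * A $$ (2,0))"
    (is "_ = ?r")
proof -
  have minor: "det (mat_delete A 0 j) =
      (let M = mat_delete A 0 j in M $$ (0,0) * M $$ (1,1) - M $$ (0,1) * M $$ (1,0))" for j
    unfolding Let_def using mat_delete_carrier[OF assms, of 0 j] by (intro det_2) simp
  have "det A = (\<Sum>j<3. A $$ (0,j) * cofactor A 0 j)"
    using assms by (rule laplace_expansion_row) simp
  also have "\<dots> = ?r"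
    using assms unfolding cofactor_def minor Let_def
    by (simp add: eval_nat_numeral mat_delete_def algebra_simps)
  finally show ?thesis .
qed

lemma det_4:
  assumes "A \<in> carrier_mat 4 4"
  shows "det A =
    A $$ (0,0) * (A $$ (1,1) * (A $$ (2,2) * A $$ (3,3) - A $$ (2,3) * A $$ (3,2))
                - A $$ (1,2) * (A $$ (2,1) * A $$ (3,3) - A $$ (2,3) * A $$ (3,1))
                + A $$ (1,3) * (A $$ (2,1) * A $$ (3,2) - A $$ (2,2) * A $$ (3,1)))
  - A $$ (0,1) * (A $$ (1,0) * (A $$ (2,2) * A $$ (3,3) - A $$ (2,3) * A $$ (3,2))
                - A $$ (1,2) * (A $$ (2,0) * A $$ (3,3) - A $$ (2,3) * A $$ (3,0))
                + A $$ (1,3) * (A $$ (2,0) * A $$ (3,2) - A $$ (2,2) * A $$ (3,0)))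
  + A $$ (0,2) * (A $$ (1,0) * (A $$ (2,1) * A $$ (3,3) - A $$ (2,3) * A $$ (3,1))
                - A $$ (1,1) * (A $$ (2,0) * A $$ (3,3) - A $$ (2,3) * A $$ (3,0))
                + A $$ (1,3) * (A $$ (2,0) * A $$ (3,1) - A $$ (2,1) * A $$ (3,0)))
  - A $$ (0,3) * (A $$ (1,0) * (A $$ (2,1) * A $$ (3,2) - A $$ (2,2) * A $$ (3,1))
                - A $$ (1,1) * (A $$ (2,0) * A $$ (3,2) - A $$ (2,2) * A $$ (3,0))
                + A $$ (1,2) * (A $$ (2,0) * A $$ (3,1) - A $$ (2,1) * A $$ (3,0)))"
    (is "_ = ?r")
proof -
  have minor: "det (mat_delete A 0 j) =
      (let M = mat_delete A 0 j in
        M $$ (0,0) * (M $$ (1,1) * M $$ (2,2) - M $$ (1,2) * M $$ (2,1))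
        - M $$ (0,1) * (M $$ (1,0) * M $$ (2,2) - M $$ (1,2) * M $$ (2,0))
        + M $$ (0,2) * (M $$ (1,0) * M $$ (2,1) - M $$ (1,1) * M $$ (2,0)))" for j
    unfolding Let_def using mat_delete_carrier[OF assms, of 0 j] by (intro det_3) simp
  have "det A = (\<Sum>j<4. A $$ (0,j) * cofactor A 0 j)"
    using assms by (rule laplace_expansion_row) simp
  also have "\<dots> = ?r"
    using assms unfolding cofactor_def minor Let_def
    by (simp add: eval_nat_numeral mat_delete_def algebra_simps)
  finally show ?thesis .
qed

text \<open>In the permutation expansion of det(x I - A), a fixed point contributes x because the
  diagonal vanishes. A cycle of length l has sign (-1)^(l-1) and picks up (-1)^l from the entries,
  so it contributes minus its weight. Hence single cycles enter negatively and pairs of disjoint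
  2-cycles positively.\<close>

lemma char_poly_4_zero_diag:
  fixes A :: "'a :: comm_ring_1 mat"
  assumes A: "A \<in> carrier_mat 4 4"
    and diag: "A $$ (0,0) = 0" "A $$ (1,1) = 0" "A $$ (2,2) = 0" "A $$ (3,3) = 0"
  shows "char_poly A =
   [: A $$ (0,1) * A $$ (1,0) * (A $$ (2,3) * A $$ (3,2))
        + A $$ (0,2) * A $$ (2,0) * (A $$ (1,3) * A $$ (3,1))
        + A $$ (0,3) * A $$ (3,0) * (A $$ (1,2) * A $$ (2,1))
        - (A $$ (0,1) * A $$ (1,2) * A $$ (2,3) * A $$ (3,0)
           + A $$ (0,1) * A $$ (1,3) * A $$ (3,2) * A $$ (2,0)
           + A $$ (0,2) * A $$ (2,1) * A $$ (1,3) * A $$ (3,0)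
           + A $$ (0,2) * A $$ (2,3) * A $$ (3,1) * A $$ (1,0)
           + A $$ (0,3) * A $$ (3,1) * A $$ (1,2) * A $$ (2,0)
           + A $$ (0,3) * A $$ (3,2) * A $$ (2,1) * A $$ (1,0)),
      - (A $$ (0,1) * A $$ (1,2) * A $$ (2,0) + A $$ (0,2) * A $$ (2,1) * A $$ (1,0)
         + A $$ (0,1) * A $$ (1,3) * A $$ (3,0) + A $$ (0,3) * A $$ (3,1) * A $$ (1,0)
         + A $$ (0,2) * A $$ (2,3) * A $$ (3,0) + A $$ (0,3) * A $$ (3,2) * A $$ (2,0)
         + A $$ (1,2) * A $$ (2,3) * A $$ (3,1) + A $$ (1,3) * A $$ (3,2) * A $$ (2,1)),
      - (A $$ (0,1) * A $$ (1,0) + A $$ (0,2) * A $$ (2,0) + A $$ (0,3) * A $$ (3,0)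
         + A $$ (1,2) * A $$ (2,1) + A $$ (1,3) * A $$ (3,1) + A $$ (2,3) * A $$ (3,2)),
      0, 1:]"
  unfolding char_poly_def
  using A diag
  by (subst det_4) (simp_all add: char_poly_matrix_def algebra_simps)

lemma coeff_char_poly_4_trace:
  fixes A :: "'a :: comm_ring_1 mat"
  assumes A: "A \<in> carrier_mat 4 4"
  shows "coeff (char_poly A) 3 = - (A $$ (0,0) + A $$ (1,1) + A $$ (2,2) + A $$ (3,3))"
  unfolding char_poly_def
  using A by (subst det_4) (simp_all add: char_poly_matrix_def algebra_simps eval_nat_numeral)

section \<open>Irreducibility as strong connectivity of the digraph\<close>

lemma index_permutation_mat_mult:
  fixes T :: "'a :: semiring_1 mat"
  assumes T: "T \<in> carrier_mat n m" and p: "p permutes {..<n}" and "i < n" "j < m"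
  shows "(mat n n (\<lambda>(i, j). if j = p i then 1 else 0) * T) $$ (i, j) = T $$ (p i, j)"
proof -
  have "p i < n"
    using permutes_in_image[OF p, of i] \<open>i < n\<close> by simp
  then show ?thesis
    using assms by (simp add: scalar_prod_def if_distrib[of "\<lambda>x. x * _"] cong: if_cong)
qed

text \<open>Multiplication from the right moves column \<open>j\<close> to position
  \<open>p j\<close>. Reading the product at \<open>p j\<close> avoids the inverse of
  \<open>p\<close>.\<close>

lemma index_mult_permutation_mat:
  fixes T :: "'a :: semiring_1 mat"
  assumes T: "T \<in> carrier_mat m n" and p: "p permutes {..<n}" and "i < m" "j < n"
  shows "(T * mat n n (\<lambda>(i, j). if j = p i then 1 else 0)) $$ (i, p j) = T $$ (i, j)"
proof -
  have "p j < n"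
    using permutes_in_image[OF p, of j] \<open>j < n\<close> by simp
  moreover have "p j = p k \<longleftrightarrow> k = j" for k
    using permutes_inj[OF p] by (auto dest: injD)
  ultimately show ?thesis
    using assms by (simp add: scalar_prod_def if_distrib[of "\<lambda>x. _ * x"] cong: if_cong)
qed

text \<open>The rows of the second diagonal block vanish in the columns of the first, so the
  vertices of the second block form a set that no edge leaves. Conversely, listing such a set last
  produces the zero block. This replaces permutation similarity by a condition on edges, which
  serves both to refute and to establish irreducibility.\<close>

lemma irreducible_mat_iff:
  assumes A: "A \<in> carrier_mat n n"
  shows "irreducible_mat A \<longleftrightarrow>
    (\<forall>S. S \<noteq> {} \<and> S \<subset> {..<n} \<longrightarrow> (\<exists>i\<in>S. \<exists>j\<in>{..<n} - S. A $$ (i, j) \<noteq> 0))"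
    (is "_ \<longleftrightarrow> ?connected")
proof
  assume conn: ?connected
  show "irreducible_mat A"
    unfolding irreducible_mat_def
  proof (intro conjI notI)
    show "square_mat A"
      using A by simp
  next
    assume "\<exists>P Q T. permutation_mat (dim_row A) P \<and> similar_mat_wit A T P Q \<and>
      block_triangular_mat (dim_row A) T"
    then obtain P Q T p k B C D where p: "p permutes {..<n}"
      and P: "P = mat n n (\<lambda>(i, j). if j = p i then 1 else 0)"
      and sim: "similar_mat_wit A T P Q"
      and k: "0 < k" "k < n" and "B \<in> carrier_mat k k" "D \<in> carrier_mat (n - k) (n - k)"
      and "T = four_block_mat B C (0\<^sub>m (n - k) k) D"
      using A unfolding permutation_mat_def block_triangular_mat_def by auto
    then have T0: "T $$ (a, b) = 0" if "k \<le> a" "a < n" "b < k" for a b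
      using that by simp
    note wit = similar_mat_witD2[OF A sim]
    \<comment> \<open>Multiplying by \<open>P\<close> on the right removes \<open>Q\<close>, so
      entries can be compared through \<open>P\<close> alone: entry \<open>(i, p j)\<close> is
      \<open>A $$ (i, j)\<close> on the left and \<open>T $$ (p i, p j)\<close> on the
      right.\<close>
    have "A * P = P * T * Q * P"
      using wit(3) by simp
    also have "\<dots> = P * T * (Q * P)"
      using wit by (intro assoc_mult_mat) auto
    finally have AP: "A * P = P * T"
      using wit by simp
    have pn: "p i < n \<longleftrightarrow> i < n" for i
      using permutes_in_image[OF p, of i] by simp
    have AT: "A $$ (i, j) = T $$ (p i, p j)" if "i < n" "j < n" for i j
      using that index_mult_permutation_mat[OF A p that]
        index_permutation_mat_mult[OF wit(5) p, of i "p j"] AP pn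
      by (simp add: P)
    \<comment> \<open>The vertices sent into the second block. The preimages of \<open>k\<close> and
      \<open>0\<close> show that this set is nonempty and proper.\<close>
    define S where "S = {i. i < n \<and> k \<le> p i}"
    obtain i j where "p i = k" "p j = 0"
      using permutes_surj[OF p] by (metis surjD)
    then have "i \<in> S" "j < n" "j \<notin> S"
      using k pn[of i] pn[of j] by (auto simp: S_def)
    then have "S \<noteq> {}" "S \<subset> {..<n}"
      by (auto simp: S_def)
    then obtain i j where "i \<in> S" "j < n" "j \<notin> S" "A $$ (i, j) \<noteq> 0"
      using conn by (meson DiffE lessThan_iff)
    then show False
      using AT[of i j] T0[of "p i" "p j"] pn by (auto simp: S_def)
  qed
next
  assume irr: "irreducible_mat A"
  show ?connected
  proof (intro allI impI, rule ccontr)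
    fix S
    assume S: "S \<noteq> {} \<and> S \<subset> {..<n}" and "\<not> (\<exists>i\<in>S. \<exists>j\<in>{..<n} - S. A $$ (i, j) \<noteq> 0)"
    then have A0: "A $$ (i, j) = 0" if "i \<in> S" "j < n" "j \<notin> S" for i j
      using that by blast
    \<comment> \<open>The zero block sits at the lower left, so the complement of \<open>S\<close>
      has to come first and determines the size of the leading block.\<close>
    define k where "k = card ({..<n} - S)"
    have fin: "finite S"
      using S finite_subset by auto
    have "k = n - card S"
      using S fin unfolding k_def by (subst card_Diff_subset) auto
    moreover have "card S < n"
      using S psubset_card_mono[of "{..<n}" S] by simp
    moreover have "0 < card S"
      using S fin by (simp add: card_gt_0_iff)
    ultimately have k: "0 < k" "k < n" "card S = card {k..<n}"
      by auto
    have "\<exists>f. bij_betw f ({..<n} - S) {..<k}"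
      by (rule finite_same_card_bij) (simp_all add: k_def)
    then obtain f where f: "bij_betw f ({..<n} - S) {..<k}" ..
    have "\<exists>g. bij_betw g S {k..<n}"
      using fin k(3) by (intro finite_same_card_bij) simp_all
    then obtain g where g: "bij_betw g S {k..<n}" ..
    \<comment> \<open>The complement of \<open>S\<close> goes to the first \<open>k\<close> indices
      and \<open>S\<close> to the remaining ones; \<open>permutes\<close> demands the identity
      outside the index range.\<close>
    define p where "p i = (if i \<in> S then g i else if i < n then f i else i)" for i
    have pS: "bij_betw p S {k..<n}"
      using bij_betw_cong[of S p g] g by (simp add: p_def)
    have pT: "bij_betw p ({..<n} - S) {..<k}"
      using bij_betw_cong[of "{..<n} - S" p f] f by (simp add: p_def)
    have "bij_betw p (S \<union> ({..<n} - S)) ({k..<n} \<union> {..<k})"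
      using pS pT by (rule bij_betw_combine) auto
    moreover have "S \<union> ({..<n} - S) = {..<n}" "{k..<n} \<union> {..<k} = {..<n}"
      using S k by auto
    ultimately have p: "p permutes {..<n}"
      using S by (intro bij_imp_permutes) (auto simp: p_def)
    have pn: "p i < n \<longleftrightarrow> i < n" for i
      using permutes_in_image[OF p, of i] by simp
    obtain q where q: "q permutes {..<n}" and inv_p: "q (p i) = i" "p (q i) = i" for i
      using permutes_inv[OF p] permutes_inverses[OF p] by blast
    have qn: "q i < n \<longleftrightarrow> i < n" for i
      using permutes_in_image[OF q, of i] by simp
    define P :: "real mat" where "P = mat n n (\<lambda>(i, j). if j = p i then 1 else 0)"
    define Q :: "real mat" where "Q = mat n n (\<lambda>(i, j). if j = q i then 1 else 0)"
    define T where "T = mat n n (\<lambda>(a, b). A $$ (q a, q b))"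
    have carr: "P \<in> carrier_mat n n" "Q \<in> carrier_mat n n" "T \<in> carrier_mat n n"
      by (auto simp: P_def Q_def T_def)
    have "P * Q = 1\<^sub>m n"
    proof (rule eq_matI)
      fix i j assume "i < dim_row (1\<^sub>m n :: real mat)" "j < dim_col (1\<^sub>m n :: real mat)"
      then show "(P * Q) $$ (i, j) = 1\<^sub>m n $$ (i, j)"
        using index_permutation_mat_mult[OF carr(2) p, of i j] pn inv_p
        by (simp add: P_def Q_def)
    qed (use carr in auto)
    moreover have "Q * P = 1\<^sub>m n"
    proof (rule eq_matI)
      fix i j assume "i < dim_row (1\<^sub>m n :: real mat)" "j < dim_col (1\<^sub>m n :: real mat)"
      then show "(Q * P) $$ (i, j) = 1\<^sub>m n $$ (i, j)"
        using index_permutation_mat_mult[OF carr(1) q, of i j] qn inv_p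
        by (simp add: P_def Q_def)
    qed (use carr in auto)
    moreover have "A = P * T * Q"
    proof (rule eq_matI)
      fix i j assume "i < dim_row (P * T * Q)" "j < dim_col (P * T * Q)"
      then have ij: "i < n" "j < n"
        using carr by auto
      then have "(P * T * Q) $$ (i, j) = (P * T) $$ (i, p j)"
        using index_mult_permutation_mat[OF mult_carrier_mat[OF carr(1,3)] q, of i "p j"]
          pn inv_p by (simp add: Q_def)
      also have "\<dots> = A $$ (i, j)"
        using index_permutation_mat_mult[OF carr(3) p, of i "p j"] ij pn inv_p
        by (simp add: P_def T_def)
      finally show "A $$ (i, j) = (P * T * Q) $$ (i, j)" ..
    qed (use carr A in auto)
    ultimately have "similar_mat_wit A T P Q"
      using A carr by (intro similar_mat_witI[of _ _ n]) auto
    moreover have "block_triangular_mat n T"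
    proof -
      define B where "B = mat k k (\<lambda>(i, j). T $$ (i, j))"
      define C where "C = mat k (n - k) (\<lambda>(i, j). T $$ (i, j + k))"
      define D where "D = mat (n - k) (n - k) (\<lambda>(i, j). T $$ (i + k, j + k))"
      have "T $$ (a, b) = 0" if "k \<le> a" "a < n" "b < k" for a b
      proof -
        have "a \<in> p ` S" "b \<in> p ` ({..<n} - S)"
          using that pS pT unfolding bij_betw_def by auto
        then have "q a \<in> S" "q b < n" "q b \<notin> S"
          using inv_p by auto
        then show ?thesis
          using A0 that k by (simp add: T_def)
      qed
      then have "T = four_block_mat B C (0\<^sub>m (n - k) k) D"
        using carr k by (intro eq_matI) (auto simp: B_def C_def D_def)
      moreover have "B \<in> carrier_mat k k" "C \<in> carrier_mat k (n - k)"
          "D \<in> carrier_mat (n - k) (n - k)"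
        by (auto simp: B_def C_def D_def)
      ultimately show ?thesis
        using k unfolding block_triangular_mat_def by blast
    qed
    moreover have "permutation_mat n P"
      using p unfolding permutation_mat_def P_def by blast
    ultimately show False
      using irr A unfolding irreducible_mat_def by auto
  qed
qed

text \<open>The criterion in the form suited to explicit matrices: each nonzero entry becomes an
  implication between memberships in \<open>S\<close>, and following these around the digraph fills
  \<open>S\<close>.\<close>

lemma irreducible_mat_4I:
  assumes "A \<in> carrier_mat 4 4"
    and closed: "\<And>S. S \<noteq> {} \<Longrightarrow> S \<subseteq> {0, 1, 2, 3} \<Longrightarrow>
      (\<And>i j. i \<in> S \<Longrightarrow> j < 4 \<Longrightarrow> A $$ (i, j) \<noteq> 0 \<Longrightarrow> j \<in> S) \<Longrightarrow> {0, 1, 2, 3} \<subseteq> S"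
  shows "irreducible_mat A"
  unfolding irreducible_mat_iff[OF assms(1)]
proof (intro allI impI, rule ccontr)
  have less4: "{..<4} = {0, 1, 2, 3::nat}"
    by auto
  fix S
  assume "S \<noteq> {} \<and> S \<subset> {..<4}" "\<not> (\<exists>i\<in>S. \<exists>j\<in>{..<4} - S. A $$ (i, j) \<noteq> 0)"
  then show False
    using closed[of S] unfolding less4[symmetric] by blast
qed

section \<open>Necessary bounds on the coefficients\<close>

lemma nonneg_mat_4_entry:
  assumes "A \<in> carrier_mat 4 4" "nonneg_mat A"
  shows "i < 4 \<Longrightarrow> j < 4 \<Longrightarrow> 0 \<le> A $$ (i, j)"
  using assms unfolding nonneg_mat_def by auto

lemma nonneg_mat_of_rows_list:
  assumes "\<And>r. r \<in> set rs \<Longrightarrow> length r = n \<and> (\<forall>x\<in>set r. 0 \<le> x)"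
  shows "nonneg_mat (mat_of_rows_list n rs)"
  unfolding nonneg_mat_def mat_of_rows_list_def using assms by (simp add: all_set_conv_all_nth)

lemma nonneg_mat_4_zero_diag:
  assumes A: "A \<in> carrier_mat 4 4" "nonneg_mat A"
    and "char_poly A = [:k4, k3, k2, 0, 1:]"
  shows "A $$ (0,0) = 0" "A $$ (1,1) = 0" "A $$ (2,2) = 0" "A $$ (3,3) = 0"
proof -
  have "A $$ (0,0) + A $$ (1,1) + A $$ (2,2) + A $$ (3,3) = 0"
    using coeff_char_poly_4_trace[OF A(1)] assms(3) by (simp add: eval_nat_numeral)
  moreover have "0 \<le> A $$ (0,0)" "0 \<le> A $$ (1,1)" "0 \<le> A $$ (2,2)" "0 \<le> A $$ (3,3)"
    using nonneg_mat_4_entry[OF A] by simp_all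
  ultimately show "A $$ (0,0) = 0" "A $$ (1,1) = 0" "A $$ (2,2) = 0" "A $$ (3,3) = 0"
    by linarith+
qed

text \<open>Applied to the weights of the six 2-cycles on four vertices, with
  \<open>x, y\<close> and \<open>z, w\<close> and \<open>u, v\<close> the three pairs of disjoint 2-cycles.\<close>

lemma four_times_pairing_le_square_sum:
  fixes x y z w u v :: real
  assumes "0 \<le> x" "0 \<le> y" "0 \<le> z" "0 \<le> w" "0 \<le> u" "0 \<le> v"
  shows "4 * (x * y + z * w + u * v) \<le> (x + y + z + w + u + v)\<^sup>2"
    and "4 * (x * y + z * w + u * v) = (x + y + z + w + u + v)\<^sup>2 \<Longrightarrow> 0 < x + y + z + w + u + v \<Longrightarrow>
      (0 < x \<and> 0 < y \<and> z = 0 \<and> w = 0 \<and> u = 0 \<and> v = 0) \<or>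
      (0 < z \<and> 0 < w \<and> x = 0 \<and> y = 0 \<and> u = 0 \<and> v = 0) \<or>
      (0 < u \<and> 0 < v \<and> x = 0 \<and> y = 0 \<and> z = 0 \<and> w = 0)"
proof -
  \<comment> \<open>Split the six weights into two sums, one member of each disjoint pair in each.
    The product of the sums consists of the three pairings and these cross terms, and four times
    that product is the square of the total minus the square of the difference.\<close>
  define r where "r = x * w + x * v + z * y + z * v + u * y + u * w"
  have nonneg: "0 \<le> x * w" "0 \<le> x * v" "0 \<le> z * y" "0 \<le> z * v" "0 \<le> u * y" "0 \<le> u * w"
    using assms by simp_all
  have "(x + z + u) * (y + w + v) = x * y + z * w + u * v + r"
    by (simp add: r_def algebra_simps)
  moreover have "(p + q)\<^sup>2 = (p - q)\<^sup>2 + 4 * (p * q)" for p q :: real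
    by (simp add: power2_eq_square algebra_simps)
  from this[of "x + z + u" "y + w + v"]
  have "(x + y + z + w + u + v)\<^sup>2 = ((x + z + u) - (y + w + v))\<^sup>2 + 4 * ((x + z + u) * (y + w + v))"
    by (simp add: add_ac)
  ultimately have eq: "(x + y + z + w + u + v)\<^sup>2 =
      4 * (x * y + z * w + u * v) + ((x + z + u) - (y + w + v))\<^sup>2 + 4 * r"
    by simp
  have "0 \<le> r"
    using nonneg by (simp add: r_def)
  then show "4 * (x * y + z * w + u * v) \<le> (x + y + z + w + u + v)\<^sup>2"
    using eq by simp
  assume "4 * (x * y + z * w + u * v) = (x + y + z + w + u + v)\<^sup>2" and pos: "0 < x + y + z + w + u + v"
  \<comment> \<open>Equality makes both the square and \<open>r\<close> vanish, so the two sums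
    balance and every cross product is zero. A positive \<open>x\<close>, \<open>z\<close> or
    \<open>u\<close> then kills two weights in the other sum, balance makes its partner positive,
    and the partner kills the rest.\<close>
  then have "((x + z + u) - (y + w + v))\<^sup>2 + 4 * r = 0"
    using eq by simp
  then have "((x + z + u) - (y + w + v))\<^sup>2 = 0" "r = 0"
    using \<open>0 \<le> r\<close> zero_le_power2[of "(x + z + u) - (y + w + v)"] by linarith+
  then have bal: "x + z + u = y + w + v"
    and "x * w = 0" "x * v = 0" "z * y = 0" "z * v = 0" "u * y = 0" "u * w = 0"
    using nonneg unfolding r_def by (simp, linarith+)
  then have zero: "x = 0 \<or> w = 0" "x = 0 \<or> v = 0" "z = 0 \<or> y = 0"
    "z = 0 \<or> v = 0" "u = 0 \<or> y = 0" "u = 0 \<or> w = 0"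
    by simp_all
  consider "0 < x" | "0 < z" | "0 < u"
    using bal pos assms by linarith
  then show "(0 < x \<and> 0 < y \<and> z = 0 \<and> w = 0 \<and> u = 0 \<and> v = 0) \<or>
      (0 < z \<and> 0 < w \<and> x = 0 \<and> y = 0 \<and> u = 0 \<and> v = 0) \<or>
      (0 < u \<and> 0 < v \<and> x = 0 \<and> y = 0 \<and> z = 0 \<and> w = 0)"
  proof cases
    case 1
    then have "w = 0" "v = 0" using zero by auto
    moreover from this have "0 < y" using 1 bal assms by linarith
    ultimately show ?thesis using 1 zero by auto
  next
    case 2
    then have "y = 0" "v = 0" using zero by auto
    moreover from this have "0 < w" using 2 bal assms by linarith
    ultimately show ?thesis using 2 zero by auto
  next
    case 3
    then have "y = 0" "w = 0" using zero by auto
    moreover from this have "0 < v" using 3 bal assms by linarith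
    ultimately show ?thesis using 3 zero by auto
  qed
qed

lemma nonneg_mat_4_coeff_bounds:
  assumes A: "A \<in> carrier_mat 4 4" "nonneg_mat A" and cp: "char_poly A = [:k4, k3, k2, 0, 1:]"
  shows "k2 \<le> 0" "k3 \<le> 0" "4 * k4 \<le> k2\<^sup>2"
proof -
  have nn: "i < 4 \<Longrightarrow> j < 4 \<Longrightarrow> 0 \<le> A $$ (i, j)" for i j
    by (rule nonneg_mat_4_entry[OF A])
  note cp4 = char_poly_4_zero_diag[OF A(1) nonneg_mat_4_zero_diag[OF A cp], unfolded cp pCons_eq_iff]
  note k4 = cp4[THEN conjunct1] and k3 = cp4[THEN conjunct2, THEN conjunct1]
    and k2 = cp4[THEN conjunct2, THEN conjunct2, THEN conjunct1]
  show "k2 \<le> 0" "k3 \<le> 0"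
    unfolding k2 k3 neg_le_0_iff_le by (intro add_nonneg_nonneg mult_nonneg_nonneg nn; simp)+
  \<comment> \<open>The 4-cycles enter \<open>k4\<close> negatively, so dropping them can only
    increase the bound.\<close>
  have "4 * k4 \<le> 4 * (A $$ (0,1) * A $$ (1,0) * (A $$ (2,3) * A $$ (3,2))
        + A $$ (0,2) * A $$ (2,0) * (A $$ (1,3) * A $$ (3,1))
        + A $$ (0,3) * A $$ (3,0) * (A $$ (1,2) * A $$ (2,1)))"
    unfolding k4 by (intro mult_left_mono diff_le_eq[THEN iffD2] le_add_same_cancel1[THEN iffD2]
      add_nonneg_nonneg mult_nonneg_nonneg nn) simp_all
  also have "\<dots> \<le> (A $$ (0,1) * A $$ (1,0) + A $$ (2,3) * A $$ (3,2) + A $$ (0,2) * A $$ (2,0)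
         + A $$ (1,3) * A $$ (3,1) + A $$ (0,3) * A $$ (3,0) + A $$ (1,2) * A $$ (2,1))\<^sup>2"
    by (intro four_times_pairing_le_square_sum mult_nonneg_nonneg nn) simp_all
  also have "A $$ (0,1) * A $$ (1,0) + A $$ (2,3) * A $$ (3,2) + A $$ (0,2) * A $$ (2,0)
         + A $$ (1,3) * A $$ (3,1) + A $$ (0,3) * A $$ (3,0) + A $$ (1,2) * A $$ (2,1) = - k2"
    unfolding k2 by simp
  finally show "4 * k4 \<le> k2\<^sup>2"
    by simp
qed

section \<open>The extremal polynomials\<close>

lemma extremal_not_irreducible:
  assumes A: "A \<in> carrier_mat 4 4" "nonneg_mat A"
    and cp: "char_poly A = [:(k2 / 2)\<^sup>2, 0, k2, 0, 1:]" and "k2 < 0"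
  shows "\<not> irreducible_mat A"
proof
  assume irr: "irreducible_mat A"
  define x y z w u v where c: "x = A $$ (0,1) * A $$ (1,0)" "y = A $$ (2,3) * A $$ (3,2)"
    "z = A $$ (0,2) * A $$ (2,0)" "w = A $$ (1,3) * A $$ (3,1)"
    "u = A $$ (0,3) * A $$ (3,0)" "v = A $$ (1,2) * A $$ (2,1)"
  have nn: "i < 4 \<Longrightarrow> j < 4 \<Longrightarrow> 0 \<le> A $$ (i, j)" for i j
    by (rule nonneg_mat_4_entry[OF A])
  note cp4 = char_poly_4_zero_diag[OF A(1) nonneg_mat_4_zero_diag[OF A cp], unfolded cp pCons_eq_iff]
  \<comment> \<open>The total weight of the 4-cycles. The pairings alone are already at most
    \<open>k2\<^sup>2 / 4\<close>, so the extremal value of the constant coefficient forces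
    \<open>f = 0\<close> as well as equality in the pairing bound.\<close>
  define f where "f = A $$ (0,1) * A $$ (1,2) * A $$ (2,3) * A $$ (3,0)
           + A $$ (0,1) * A $$ (1,3) * A $$ (3,2) * A $$ (2,0)
           + A $$ (0,2) * A $$ (2,1) * A $$ (1,3) * A $$ (3,0)
           + A $$ (0,2) * A $$ (2,3) * A $$ (3,1) * A $$ (1,0)
           + A $$ (0,3) * A $$ (3,1) * A $$ (1,2) * A $$ (2,0)
           + A $$ (0,3) * A $$ (3,2) * A $$ (2,1) * A $$ (1,0)"
  have "0 \<le> f"
    using nn by (simp add: f_def)
  have c_nonneg: "0 \<le> x" "0 \<le> y" "0 \<le> z" "0 \<le> w" "0 \<le> u" "0 \<le> v"
    using nn by (simp_all add: c)
  have total: "x + y + z + w + u + v = - k2"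
    using cp4 by (simp add: c)
  have "(k2 / 2)\<^sup>2 = x * y + z * w + u * v - f"
    unfolding c f_def by (rule conjunct1[OF cp4])
  then have "k2\<^sup>2 = 4 * (x * y + z * w + u * v) - 4 * f"
    by (simp add: power_divide)
  moreover have "4 * (x * y + z * w + u * v) \<le> k2\<^sup>2"
    using four_times_pairing_le_square_sum(1)[OF c_nonneg] total by simp
  ultimately have "f = 0" and extremal: "4 * (x * y + z * w + u * v) = (x + y + z + w + u + v)\<^sup>2"
    using \<open>0 \<le> f\<close> total by simp_all
  \<comment> \<open>A vanishing sum of nonnegative terms vanishes termwise. Deleting
    \<open>mult_eq_0_iff\<close> keeps the cycle products whole while the sum is split.\<close>
  have four: "A $$ (0,1) * A $$ (1,2) * A $$ (2,3) * A $$ (3,0) = 0"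
    "A $$ (0,1) * A $$ (1,3) * A $$ (3,2) * A $$ (2,0) = 0"
    "A $$ (0,2) * A $$ (2,1) * A $$ (1,3) * A $$ (3,0) = 0"
    "A $$ (0,2) * A $$ (2,3) * A $$ (3,1) * A $$ (1,0) = 0"
    "A $$ (0,3) * A $$ (3,1) * A $$ (1,2) * A $$ (2,0) = 0"
    "A $$ (0,3) * A $$ (3,2) * A $$ (2,1) * A $$ (1,0) = 0"
    using \<open>f = 0\<close> nn by (simp_all add: f_def add_nonneg_eq_0_iff del: mult_eq_0_iff)
  have "A $$ (0,1) * A $$ (1,2) * A $$ (2,0) + A $$ (0,2) * A $$ (2,1) * A $$ (1,0)
         + A $$ (0,1) * A $$ (1,3) * A $$ (3,0) + A $$ (0,3) * A $$ (3,1) * A $$ (1,0)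
         + A $$ (0,2) * A $$ (2,3) * A $$ (3,0) + A $$ (0,3) * A $$ (3,2) * A $$ (2,0)
         + A $$ (1,2) * A $$ (2,3) * A $$ (3,1) + A $$ (1,3) * A $$ (3,2) * A $$ (2,1) = 0"
    using cp4 by simp
  then have three: "A $$ (0,1) * A $$ (1,2) * A $$ (2,0) = 0"
    "A $$ (0,2) * A $$ (2,1) * A $$ (1,0) = 0"
    "A $$ (0,1) * A $$ (1,3) * A $$ (3,0) = 0"
    "A $$ (0,3) * A $$ (3,1) * A $$ (1,0) = 0"
    "A $$ (0,2) * A $$ (2,3) * A $$ (3,0) = 0"
    "A $$ (0,3) * A $$ (3,2) * A $$ (2,0) = 0"
    "A $$ (1,2) * A $$ (2,3) * A $$ (3,1) = 0"
    "A $$ (1,3) * A $$ (3,2) * A $$ (2,1) = 0"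
    using nn by (simp_all add: add_nonneg_eq_0_iff del: mult_eq_0_iff)
  have less4: "{..<4} = {0, 1, 2, 3::nat}"
    by auto
  \<comment> \<open>The given \<open>i\<close> and \<open>j\<close> only witness that
    \<open>S\<close> is nonempty and proper; irreducibility then supplies an edge out of
    \<open>S\<close>.\<close>
  have leaves: "\<exists>i\<in>S. \<exists>j\<in>{0, 1, 2, 3}. j \<notin> S \<and> A $$ (i, j) \<noteq> 0"
    if "i \<in> S" "S \<subseteq> {0, 1, 2, 3}" "j \<in> {0, 1, 2, 3}" "j \<notin> S" for i j S
    using irr that unfolding irreducible_mat_iff[OF A(1)] less4 by (metis DiffE empty_iff psubsetI)
  txt \<open>An edge between the two surviving 2-cycles and an edge back would close
    a cycle of length 2, 3 or 4 of positive weight.\<close>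
  have "0 < x + y + z + w + u + v"
    using total \<open>k2 < 0\<close> by simp
  then consider "0 < x \<and> 0 < y \<and> z = 0 \<and> w = 0 \<and> u = 0 \<and> v = 0" |
    "0 < z \<and> 0 < w \<and> x = 0 \<and> y = 0 \<and> u = 0 \<and> v = 0" |
    "0 < u \<and> 0 < v \<and> x = 0 \<and> y = 0 \<and> z = 0 \<and> w = 0"
    using four_times_pairing_le_square_sum(2)[OF c_nonneg extremal] by blast
  then show False
  proof cases
    case 1
    then have "A $$ (0,1) \<noteq> 0" "A $$ (1,0) \<noteq> 0" "A $$ (2,3) \<noteq> 0" "A $$ (3,2) \<noteq> 0"
      by (auto simp: c)
    then show False
      using 1 leaves[of 0 "{0, 1}" 2] leaves[of 2 "{2, 3}" 0] three four by (simp add: c) argo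
  next
    case 2
    then have "A $$ (0,2) \<noteq> 0" "A $$ (2,0) \<noteq> 0" "A $$ (1,3) \<noteq> 0" "A $$ (3,1) \<noteq> 0"
      by (auto simp: c)
    then show False
      using 2 leaves[of 0 "{0, 2}" 1] leaves[of 1 "{1, 3}" 0] three four by (simp add: c) argo
  next
    case 3
    then have "A $$ (0,3) \<noteq> 0" "A $$ (3,0) \<noteq> 0" "A $$ (1,2) \<noteq> 0" "A $$ (2,1) \<noteq> 0"
      by (auto simp: c)
    then show False
      using 3 leaves[of 0 "{0, 3}" 1] leaves[of 1 "{1, 2}" 0] three four by (simp add: c) argo
  qed
qed

section \<open>Explicit irreducible realizations\<close>

lemma irreducible_realization:
  fixes k2 k3 k4 :: real
  assumes "k2 \<le> 0" "k3 \<le> 0" "4 * k4 \<le> k2\<^sup>2"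
    and not_zero: "\<not> (k2 = 0 \<and> k3 = 0 \<and> k4 = 0)"
    and not_extremal: "\<not> (k2 < 0 \<and> k3 = 0 \<and> k4 = (k2 / 2)\<^sup>2)"
  obtains A where "A \<in> carrier_mat 4 4" "nonneg_mat A" "irreducible_mat A"
    "char_poly A = [:k4, k3, k2, 0, 1:]"
proof -
  consider "k4 < 0" | "k4 = 0" | "0 < k4"
    by linarith
  then show ?thesis
  proof cases
    case 1
    \<comment> \<open>A companion matrix up to arrangement: the only cycles are 0-1, 0-1-2 and
      0-1-2-3, of weights \<open>- k2\<close>, \<open>- k3\<close> and \<open>- k4\<close>. The last
      is positive, so the 4-cycle alone gives strong connectivity.\<close>
    define A where "A = mat_of_rows_list 4
      [[0, 1, 0, 0], [- k2, 0, 1, 0], [- k3, 0, 0, 1], [- k4, 0, 0, 0]]"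
    have A: "A \<in> carrier_mat 4 4"
      by (auto simp: A_def mat_of_rows_list_def)
    moreover have "nonneg_mat A"
      using assms(1,2) 1 unfolding A_def by (intro nonneg_mat_of_rows_list) auto
    moreover have "irreducible_mat A"
    proof (rule irreducible_mat_4I[OF A])
      fix S :: "nat set"
      assume S: "S \<noteq> {}" "S \<subseteq> {0, 1, 2, 3}"
        and closed: "\<And>i j. i \<in> S \<Longrightarrow> j < 4 \<Longrightarrow> A $$ (i, j) \<noteq> 0 \<Longrightarrow> j \<in> S"
      have "0 \<in> S \<longrightarrow> 1 \<in> S" "1 \<in> S \<longrightarrow> 2 \<in> S" "2 \<in> S \<longrightarrow> 3 \<in> S" "3 \<in> S \<longrightarrow> 0 \<in> S"
        using closed[of 0 1] closed[of 1 2] closed[of 2 3] closed[of 3 0] 1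
        by (simp_all add: A_def mat_of_rows_list_def)
      then show "{0, 1, 2, 3} \<subseteq> S"
        using S by blast
    qed
    moreover have "char_poly A = [:k4, k3, k2, 0, 1:]"
      by (subst char_poly_4_zero_diag[OF A]) (auto simp: A_def mat_of_rows_list_def)
    ultimately show ?thesis
      by (rule that)
  next
    case 2
    \<comment> \<open>All 2-cycles will pass through vertex 1, so no two are disjoint, and there is
      no 4-cycle. The weight \<open>- k2\<close> is shared by three 2-cycles and \<open>- k3\<close>
      by two 3-cycles, so that either of \<open>b\<close> and \<open>c\<close> being nonzero already
      connects the digraph.\<close>
    define b c where "b = - k3 / 2" and "c = - k2 / 3"
    have bc: "0 \<le> b" "0 \<le> c" "b \<noteq> 0 \<or> c \<noteq> 0"
      using assms 2 by (auto simp: b_def c_def)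
    define A where "A = mat_of_rows_list 4
      [[0, 1, 0, 0], [c, 0, 1, 1], [b, c, 0, 0], [b, c, 0, 0]]"
    have A: "A \<in> carrier_mat 4 4"
      by (auto simp: A_def mat_of_rows_list_def)
    moreover have "nonneg_mat A"
      using bc unfolding A_def by (intro nonneg_mat_of_rows_list) auto
    moreover have "irreducible_mat A"
    proof (rule irreducible_mat_4I[OF A])
      fix S :: "nat set"
      assume S: "S \<noteq> {}" "S \<subseteq> {0, 1, 2, 3}"
        and closed: "\<And>i j. i \<in> S \<Longrightarrow> j < 4 \<Longrightarrow> A $$ (i, j) \<noteq> 0 \<Longrightarrow> j \<in> S"
      have "0 \<in> S \<longrightarrow> 1 \<in> S" "1 \<in> S \<longrightarrow> 2 \<in> S" "1 \<in> S \<longrightarrow> 3 \<in> S"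
        using closed[of 0 1] closed[of 1 2] closed[of 1 3]
        by (simp_all add: A_def mat_of_rows_list_def)
      moreover have "1 \<in> S \<longrightarrow> 0 \<in> S" "2 \<in> S \<longrightarrow> 1 \<in> S" "3 \<in> S \<longrightarrow> 1 \<in> S" if "c \<noteq> 0"
        using closed[of 1 0] closed[of 2 1] closed[of 3 1] that
        by (simp_all add: A_def mat_of_rows_list_def)
      moreover have "2 \<in> S \<longrightarrow> 0 \<in> S" "3 \<in> S \<longrightarrow> 0 \<in> S" if "b \<noteq> 0"
        using closed[of 2 0] closed[of 3 0] that
        by (simp_all add: A_def mat_of_rows_list_def)
      ultimately show "{0, 1, 2, 3} \<subseteq> S"
        using S bc(3) by blast
    qed
    moreover have "char_poly A = [:k4, k3, k2, 0, 1:]"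
      using 2 by (subst char_poly_4_zero_diag[OF A])
        (auto simp: A_def b_def c_def mat_of_rows_list_def)
    ultimately show ?thesis
      by (rule that)
  next
    case 3
    \<comment> \<open>The 2-cycles 0-1 and 2-3 get weight \<open>r\<close> each, so their product is
      \<open>k4\<close>. The 2-cycle 1-2 takes the remaining weight \<open>z\<close>, and the single
      3-cycle 0-2-1 has weight \<open>- k3\<close>. Vertex 3 is joined only to vertex 2, which
      excludes 4-cycles.\<close>
    define r where "r = sqrt k4"
    have r: "0 < r" "r * r = k4"
      using 3 by (simp_all add: r_def)
    define z where "z = - k2 - 2 * r"
    have "(2 * r)\<^sup>2 \<le> (- k2)\<^sup>2"
      using assms(3) r by (simp add: power2_eq_square)
    then have "0 \<le> z"
      using power2_le_imp_le[of "2 * r" "- k2"] assms(1) by (simp add: z_def)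
    \<comment> \<open>The only possible edges from the vertices 0, 1 to the vertices 2, 3 have
      weights \<open>z\<close> and \<open>- k3\<close>; both vanish only in the excluded extremal
      case.\<close>
    have "z \<noteq> 0 \<or> k3 \<noteq> 0"
    proof (rule ccontr)
      assume "\<not> ?thesis"
      then have "k2 = - 2 * r" "k3 = 0"
        by (simp_all add: z_def)
      then show False
        using not_extremal r by (simp add: power2_eq_square)
    qed
    define A where "A = mat_of_rows_list 4
      [[0, r, - k3, 0], [1, 0, z, 0], [0, 1, 0, r], [0, 0, 1, 0]]"
    have A: "A \<in> carrier_mat 4 4"
      by (auto simp: A_def mat_of_rows_list_def)
    moreover have "nonneg_mat A"
      using assms(2) \<open>0 < r\<close> \<open>0 \<le> z\<close> unfolding A_def by (intro nonneg_mat_of_rows_list) auto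
    moreover have "irreducible_mat A"
    proof (rule irreducible_mat_4I[OF A])
      fix S :: "nat set"
      assume S: "S \<noteq> {}" "S \<subseteq> {0, 1, 2, 3}"
        and closed: "\<And>i j. i \<in> S \<Longrightarrow> j < 4 \<Longrightarrow> A $$ (i, j) \<noteq> 0 \<Longrightarrow> j \<in> S"
      have "3 \<in> S \<longrightarrow> 2 \<in> S" "2 \<in> S \<longrightarrow> 3 \<in> S" "2 \<in> S \<longrightarrow> 1 \<in> S" "1 \<in> S \<longrightarrow> 0 \<in> S" "0 \<in> S \<longrightarrow> 1 \<in> S"
        using closed[of 3 2] closed[of 2 3] closed[of 2 1] closed[of 1 0] closed[of 0 1] r
        by (simp_all add: A_def mat_of_rows_list_def)
      moreover have "1 \<in> S \<longrightarrow> 2 \<in> S" if "z \<noteq> 0"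
        using closed[of 1 2] that by (simp add: A_def mat_of_rows_list_def)
      moreover have "0 \<in> S \<longrightarrow> 2 \<in> S" if "k3 \<noteq> 0"
        using closed[of 0 2] that by (simp add: A_def mat_of_rows_list_def)
      ultimately show "{0, 1, 2, 3} \<subseteq> S"
        using S \<open>z \<noteq> 0 \<or> k3 \<noteq> 0\<close> by blast
    qed
    moreover have "char_poly A = [:k4, k3, k2, 0, 1:]"
      using r by (subst char_poly_4_zero_diag[OF A])
        (auto simp: A_def z_def mat_of_rows_list_def)
    ultimately show ?thesis
      by (rule that)
  qed
qed

theorem theorem25:
  fixes k2 k3 k4 :: real and P :: "real poly"
  assumes "P = [:k4, k3, k2, 0, 1:]"
    and "P \<noteq> monom 1 4"
  shows "(\<not> (k2 < 0 \<and> P = [:(k2 / 2)\<^sup>2, 0, k2, 0, 1:]) \<longrightarrow>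
            (realizable P \<longleftrightarrow> irreducibly_realizable P)) \<and>
         (k2 < 0 \<and> P = [:(k2 / 2)\<^sup>2, 0, k2, 0, 1:] \<longrightarrow> \<not> irreducibly_realizable P)"
proof (intro conjI impI)
  have deg: "degree P = 4"
    using assms(1) by simp
  \<comment> \<open>Excluding x^4 keeps \<open>b\<close> and \<open>c\<close> in the construction
    for \<open>k4 = 0\<close> from vanishing together.\<close>
  have not_zero: "\<not> (k2 = 0 \<and> k3 = 0 \<and> k4 = 0)"
    using assms by (auto simp: monom_altdef eval_nat_numeral)
  {
    assume excl: "\<not> (k2 < 0 \<and> P = [:(k2 / 2)\<^sup>2, 0, k2, 0, 1:])"
    show "realizable P \<longleftrightarrow> irreducibly_realizable P"
    proof
      assume "realizable P"
      then obtain B where "B \<in> carrier_mat 4 4" "nonneg_mat B" "char_poly B = [:k4, k3, k2, 0, 1:]"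
        using assms(1) unfolding realizable_def deg by blast
      \<comment> \<open>\<open>B\<close> serves only to bound the coefficients; the irreducible
        matrix is built afresh from them.\<close>
      note bounds = nonneg_mat_4_coeff_bounds[OF this]
      have "\<not> (k2 < 0 \<and> k3 = 0 \<and> k4 = (k2 / 2)\<^sup>2)"
        using excl assms(1) by auto
      then obtain A where "A \<in> carrier_mat 4 4" "nonneg_mat A" "irreducible_mat A"
        "char_poly A = P"
        using irreducible_realization[OF bounds not_zero] assms(1) by metis
      then show "irreducibly_realizable P"
        unfolding irreducibly_realizable_def deg by blast
    qed (auto simp: realizable_def irreducibly_realizable_def)
  }
  assume ext: "k2 < 0 \<and> P = [:(k2 / 2)\<^sup>2, 0, k2, 0, 1:]"
  show "\<not> irreducibly_realizable P"
    using extremal_not_irreducible[of _ k2] ext unfolding irreducibly_realizable_def deg by blast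
qed

end
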